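(* Let $\hat{\boldsymbol p}_n$ be the empirical p.m.f. of a sample of size $n\ge2$ from an arbitrary distribution $\boldsymbol p$ on $\mathbb N=\{0,1,2,\dots\}$, and let $\hat{\boldsymbol\phi}_n$ be the one-dimensional (decreasing) Grenander–Stone estimator with mixture parameter selected by leave-one-out cross-validation with loss $L_1$ or $L_2$. Put $\hat F_{n,j}=\sum_{k=0}^j\hat p_{n,k}$ and $\hat F^{GS}_{n,j}=\sum_{k=0}^j\hat\phi_{n,k}$ for $j\in\mathbb N$. Then, for the cumulative distribution function $D=(D_j)_{j\in\mathbb N}$ of any decreasing distribution on $\mathbb N$, $$\|\hat F^{GS}_n-D\|_\infty\le\|\hat F_n-D\|_\infty .$$
   Context: "Decreasing" means non-increasing: a probability vector $(f_j)_{j\in\mathbb N}$ is decreasing if $f_0\ge f_1\ge f_2\ge\cdots$; and $\|F\|_\infty=\sup_{j\in\mathbb N}|F_j|$. For a sample $z_1,\dots,z_n\in\mathbb N$: $x_j=\sum_{i=1}^n1\{z_i=j\}$, $t_n=\sup\{j:x_j>0\}$, $\hat p_{n,j}=x_j/n$. For a probability vector $\boldsymbol f$ on $\mathbb N$, $\Pi^{is}(\boldsymbol f)$ denotes the $\ell_2$-projection of $\boldsymbol f$ onto the set of decreasing probability vectors on $\mathbb N$ (so $\hat{\boldsymbol g}_n=\Pi^{is}(\hat{\boldsymbol p}_n)$ is the Grenander estimator). The Grenander–Stone estimator is $\hat{\boldsymbol\phi}_n=\beta^{(L_d)}_n\Pi^{is}(\hat{\boldsymbol p}_n)+(1-\beta^{(L_d)}_n)\hat{\boldsymbol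 p}_n$, $d\in\{1,2\}$, with $\beta^{(L_d)}_n\in[0,1]$ defined as follows. For $j$ with $x_j>0$ let $\hat{\boldsymbol g}^{\backslash[j]}_n=\Pi^{is}\big((\boldsymbol x-\boldsymbol\sigma^{[j]})/(n-1)\big)$, where $\boldsymbol\sigma^{[j]}$ has entry $1$ at index $j$ and $0$ elsewhere; for $j$ with $x_j=0$ put $\hat{\boldsymbol g}^{\backslash[j]}_n=0$ (irrelevant below). For $L_1$: $\beta^{(L_1)}_n=0$ if $\sum_{j=0}^{t_n}\{(x_j-n\hat g^{\backslash[j]}_{n,j})^2+(n+1)\hat g^{\backslash[j]}_{n,j}(x_j-n\hat g^{\backslash[j]}_{n,j})+n(\hat g^{\backslash[j]}_{n,j})^2\}\ge n$, and $\beta^{(L_1)}_n=1$ otherwise. For $L_2$: $\beta^{(L_2)}_n=b_n/a_n$ if $a_n\ne0$ and $0\le b_n\le a_n$; $\beta^{(L_2)}_n=0$ if $a_n=0$ or $b_n<0$; $\beta^{(L_2)}_n=1$ otherwise, where $$a_n=n-\sum_{j=0}^{t_n}x_j\Big\{2(x_j-\hat g^{\backslash[j]}_{n,j}(n-1))-\sum_{k=0}^{t_n}(x_k-(n-1)\hat g^{\backslash[j]}_{n,k})^2\Big\},$$ $$b_n=n^2-\sum_{j=0}^{t_n}x_j^2+(n-1)\sum_{j=0}^{t_n}x_j\sum_{k=0}^{t_n}x_k(\hat g^{\backslash[k]}_{n,k}-\hat g^{\backslash[j]}_{n,k}).$$ *)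

theory Defs
  imports Complex_Main
begin

definition prob_vector :: "(nat \<Rightarrow> real) \<Rightarrow> bool" where
  "prob_vector f \<longleftrightarrow> (\<forall>j. 0 \<le> f j) \<and> f sums 1"

definition decreasing_pmfs :: "(nat \<Rightarrow> real) set" where
  "decreasing_pmfs = {f. prob_vector f \<and> decseq f}"

text \<open>Both norms below are meaningful only for square-summable, respectively bounded, sequences.
  They are applied to differences of probability vectors, respectively of distribution functions.\<close>

definition l2_norm :: "(nat \<Rightarrow> real) \<Rightarrow> real" where
  "l2_norm v = sqrt (\<Sum>j. (v j)\<^sup>2)"

definition sup_norm :: "(nat \<Rightarrow> real) \<Rightarrow> real" where
  "sup_norm v = (SUP j. \<bar>v j\<bar>)"

definition cumulative :: "(nat \<Rightarrow> real) \<Rightarrow> nat \<Rightarrow> real" where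
  "cumulative f j = (\<Sum>k=0..j. f k)"

definition iso_proj :: "(nat \<Rightarrow> real) \<Rightarrow> nat \<Rightarrow> real" where
  "iso_proj f = arg_min_on (\<lambda>g. l2_norm (\<lambda>j. f j - g j)) decreasing_pmfs"

text \<open>A sample of size \<open>n\<close> is given by the values \<open>z 1, \<dots>, z n\<close> of a function \<open>z\<close>;
  its other values play no role. Counts are taken as real numbers, so that no subtraction
  below is truncated.\<close>

definition freq :: "nat \<Rightarrow> (nat \<Rightarrow> nat) \<Rightarrow> nat \<Rightarrow> real" where
  "freq n z j = (\<Sum>i=1..n. of_bool (z i = j))"

definition max_obs :: "nat \<Rightarrow> (nat \<Rightarrow> nat) \<Rightarrow> nat" where
  "max_obs n z = Sup {j. freq n z j > 0}"

definition empirical_pmf :: "nat \<Rightarrow> (nat \<Rightarrow> nat) \<Rightarrow> nat \<Rightarrow> real" where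
  "empirical_pmf n z j = freq n z j / real n"

definition grenander :: "nat \<Rightarrow> (nat \<Rightarrow> nat) \<Rightarrow> nat \<Rightarrow> real" where
  "grenander n z = iso_proj (empirical_pmf n z)"

text \<open>\<open>loo_grenander n z j\<close> is the Grenander estimator of the sample from which one observation
  equal to \<open>j\<close> has been removed.\<close>

definition loo_grenander :: "nat \<Rightarrow> (nat \<Rightarrow> nat) \<Rightarrow> nat \<Rightarrow> nat \<Rightarrow> real" where
  "loo_grenander n z j =
     (if freq n z j > 0
      then iso_proj (\<lambda>k. (freq n z k - of_bool (k = j)) / (real n - 1))
      else (\<lambda>k. 0))"

datatype loss = L1 | L2

definition beta_L1 :: "nat \<Rightarrow> (nat \<Rightarrow> nat) \<Rightarrow> real" where
  "beta_L1 n z =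
     (let x = freq n z; g = loo_grenander n z in
      if (\<Sum>j=0..max_obs n z.
            (x j - real n * g j j)\<^sup>2 + (real n + 1) * g j j * (x j - real n * g j j)
              + real n * (g j j)\<^sup>2) \<ge> real n
      then 0 else 1)"

definition a_L2 :: "nat \<Rightarrow> (nat \<Rightarrow> nat) \<Rightarrow> real" where
  "a_L2 n z =
     (let x = freq n z; g = loo_grenander n z; t = max_obs n z in
      real n - (\<Sum>j=0..t. x j * (2 * (x j - g j j * (real n - 1))
                  - (\<Sum>k=0..t. (x k - (real n - 1) * g j k)\<^sup>2))))"

definition b_L2 :: "nat \<Rightarrow> (nat \<Rightarrow> nat) \<Rightarrow> real" where
  "b_L2 n z =
     (let x = freq n z; g = loo_grenander n z; t = max_obs n z in
      (real n)\<^sup>2 - (\<Sum>j=0..t. (x j)\<^sup>2)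
        + (real n - 1) * (\<Sum>j=0..t. x j * (\<Sum>k=0..t. x k * (g k k - g j k))))"

definition beta_L2 :: "nat \<Rightarrow> (nat \<Rightarrow> nat) \<Rightarrow> real" where
  "beta_L2 n z =
     (let a = a_L2 n z; b = b_L2 n z in
      if a \<noteq> 0 \<and> 0 \<le> b \<and> b \<le> a then b / a
      else if a = 0 \<or> b < 0 then 0
      else 1)"

fun mixture_param :: "loss \<Rightarrow> nat \<Rightarrow> (nat \<Rightarrow> nat) \<Rightarrow> real" where
  "mixture_param L1 n z = beta_L1 n z"
| "mixture_param L2 n z = beta_L2 n z"

definition grenander_stone :: "loss \<Rightarrow> nat \<Rightarrow> (nat \<Rightarrow> nat) \<Rightarrow> nat \<Rightarrow> real" where
  "grenander_stone L n z j =
     mixture_param L n z * grenander n z j + (1 - mixture_param L n z) * empirical_pmf n z j"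

end

theory Submission
  imports Defs
begin

text \<open>The isotonic projection of a probability vector \<open>p\<close> is the slope sequence of the least concave
  majorant of the cumulative sums of \<open>p\<close>. This is verified through the variational inequality:
  summation by parts reduces it to the facts that the majorant lies above the cumulative sums
  and is affine wherever it does not touch them.
  If \<open>F\<close> is within \<open>\<epsilon>\<close> of a concave \<open>D\<close>, then \<open>D + \<epsilon>\<close> is a concave majorant of \<open>F\<close>, so the least one
  is squeezed between \<open>F \<ge> D - \<epsilon>\<close> and \<open>D + \<epsilon>\<close> (Marshall's inequality). The Grenander--Stone estimator
  is a convex combination of \<open>F\<close> and its projection, whichever way the mixture parameter is selected.\<close>

section \<open>Least concave majorants of sequences\<close>

definition concave_seq :: "(nat \<Rightarrow> real) \<Rightarrow> bool" where
  "concave_seq c \<longleftrightarrow> (\<forall>k. c k + c (Suc (Suc k)) \<le> 2 * c (Suc k))"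

definition concave_majorants :: "(nat \<Rightarrow> real) \<Rightarrow> (nat \<Rightarrow> real) set" where
  "concave_majorants s = {c. concave_seq c \<and> (\<forall>k. s k \<le> c k)}"

definition lcmaj :: "(nat \<Rightarrow> real) \<Rightarrow> nat \<Rightarrow> real" where
  "lcmaj s k = (INF c\<in>concave_majorants s. c k)"

lemma concave_seq_iff_decseq: "concave_seq c \<longleftrightarrow> decseq (\<lambda>k. c (Suc k) - c k)"
  unfolding concave_seq_def decseq_Suc_iff by (simp add: algebra_simps)

lemma lcmaj_least: "c \<in> concave_majorants s \<Longrightarrow> lcmaj s k \<le> c k"
  unfolding lcmaj_def
  by (rule cINF_lower) (auto simp: bdd_below_def concave_majorants_def)

lemma lcmaj_greatest:
  assumes "concave_majorants s \<noteq> {}" "\<And>c. c \<in> concave_majorants s \<Longrightarrow> x \<le> c k"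
  shows "x \<le> lcmaj s k"
  unfolding lcmaj_def using assms by (rule cINF_greatest)

text \<open>A pointwise infimum of concave sequences is concave: the average of its values at
  \<open>k\<close> and \<open>k + 2\<close> bounds \<open>c (Suc k)\<close> from below for every
  concave majorant \<open>c\<close>.\<close>

lemma lcmaj_in_concave_majorants:
  assumes "concave_majorants s \<noteq> {}"
  shows "lcmaj s \<in> concave_majorants s"
proof -
  have "lcmaj s k + lcmaj s (Suc (Suc k)) \<le> 2 * lcmaj s (Suc k)" for k
  proof -
    have "(lcmaj s k + lcmaj s (Suc (Suc k))) / 2 \<le> c (Suc k)" if c: "c \<in> concave_majorants s" for c
    proof -
      have "c k + c (Suc (Suc k)) \<le> 2 * c (Suc k)"
        using c by (simp add: concave_majorants_def concave_seq_def)
      with lcmaj_least[OF c, of k] lcmaj_least[OF c, of "Suc (Suc k)"] show ?thesis by simp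
    qed
    then have "(lcmaj s k + lcmaj s (Suc (Suc k))) / 2 \<le> lcmaj s (Suc k)"
      by (rule lcmaj_greatest[OF assms])
    then show ?thesis by simp
  qed
  moreover have "s k \<le> lcmaj s k" for k
    by (rule lcmaj_greatest[OF assms]) (simp add: concave_majorants_def)
  ultimately show ?thesis by (simp add: concave_majorants_def concave_seq_def)
qed

text \<open>Otherwise the value of the majorant at the single point \<open>Suc k\<close> could be lowered.\<close>

lemma lcmaj_affine_off_contact:
  assumes ne: "concave_majorants s \<noteq> {}" and off: "s (Suc k) < lcmaj s (Suc k)"
  shows "lcmaj s (Suc (Suc k)) - lcmaj s (Suc k) = lcmaj s (Suc k) - lcmaj s k"
proof -
  define m where "m = lcmaj s"
  \<comment> \<open>The lowest value at \<open>Suc k\<close> that stays above \<open>s\<close> and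
    keeps concavity there. Concavity at the other points survives, since lowering an endpoint only
    helps.\<close>
  define v where "v = max (s (Suc k)) ((m k + m (Suc (Suc k))) / 2)"
  from lcmaj_in_concave_majorants[OF ne]
  have conc: "m i + m (Suc (Suc i)) \<le> 2 * m (Suc i)" and maj: "s i \<le> m i" for i
    by (auto simp: m_def concave_majorants_def concave_seq_def)
  have v: "v \<le> m (Suc k)" using conc[of k] maj[of "Suc k"] by (simp add: v_def)
  have "(m k + m (Suc (Suc k))) / 2 \<le> v" unfolding v_def by (rule max.cobounded2)
  then have v2: "m k + m (Suc (Suc k)) \<le> 2 * v" by simp
  have "m(Suc k := v) \<in> concave_majorants s"
    unfolding concave_majorants_def concave_seq_def mem_Collect_eq
  proof (intro conjI allI)
    fix i
    show "(m(Suc k := v)) i + (m(Suc k := v)) (Suc (Suc i)) \<le> 2 * (m(Suc k := v)) (Suc i)"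
      using conc[of i] v v2 by (cases "i = k") auto
    show "s i \<le> (m(Suc k := v)) i" using maj[of i] by (simp add: v_def)
  qed
  from lcmaj_least[OF this, of "Suc k"] have "m (Suc k) \<le> v" by (simp add: m_def)
  with off have "m (Suc k) \<le> (m k + m (Suc (Suc k))) / 2"
    unfolding v_def m_def le_max_iff_disj by (simp add: not_le[symmetric])
  with conc[of k] show ?thesis by (simp add: m_def)
qed

text \<open>Moves the difference from \<open>e\<close> to \<open>u\<close>, so that signs of
  \<open>e\<close> can be combined with monotonicity of \<open>u\<close>. The boundary term is kept
  because the sums are finite truncations of series.\<close>

lemma summation_by_parts:
  fixes e u :: "nat \<Rightarrow> 'a::comm_ring"
  shows "(\<Sum>k<n. (e (Suc k) - e k) * u k) =
    e n * u n - e 0 * u 0 + (\<Sum>k<n. e (Suc k) * (u k - u (Suc k)))"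
  by (induction n) (simp_all add: algebra_simps)

section \<open>The isotonic projection\<close>

lemma prob_vector_le_1:
  assumes "prob_vector p"
  shows "(\<Sum>k<m. p k) \<le> 1" "p k \<le> 1"
proof -
  show le: "(\<Sum>k<m. p k) \<le> 1" for m
    using assms sum_le_suminf[of p "{..<m}"]
    by (auto simp: prob_vector_def sums_iff)
  have "p k \<le> (\<Sum>k<Suc k. p k)"
    using assms by (auto simp: prob_vector_def intro!: sum_nonneg)
  with le[of "Suc k"] show "p k \<le> 1" by simp
qed

lemma summable_prob_vector_mult:
  assumes "prob_vector p" "prob_vector q"
  shows "summable (\<lambda>k. p k * q k)"
proof (rule summable_comparison_test)
  show "summable p" using assms(1) by (auto simp: prob_vector_def sums_iff)
  have "p k * q k \<le> p k * 1" for k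
    using assms prob_vector_le_1(2)[OF assms(2)]
    by (intro mult_left_mono) (auto simp: prob_vector_def)
  then show "\<exists>N. \<forall>k\<ge>N. norm (p k * q k) \<le> p k"
    using assms by (auto simp: prob_vector_def)
qed

lemma summable_prob_vector_diff_mult:
  assumes "prob_vector p" "prob_vector q" "prob_vector p'" "prob_vector q'"
  shows "summable (\<lambda>k. (p k - q k) * (p' k - q' k))"
  unfolding left_diff_distrib right_diff_distrib
  using assms by (intro summable_diff summable_prob_vector_mult)

text \<open>Partial sums over \<open>k < m\<close> start with the empty sum, so the origin belongs
  to the graph being majorized and the slope at index 0 is the first entry of the
  projection.\<close>

definition lcmaj_slopes :: "(nat \<Rightarrow> real) \<Rightarrow> nat \<Rightarrow> real" where
  "lcmaj_slopes p k = lcmaj (\<lambda>m. \<Sum>k<m. p k) (Suc k) - lcmaj (\<lambda>m. \<Sum>k<m. p k) k"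

context
  fixes p :: "nat \<Rightarrow> real"
  assumes p: "prob_vector p"
begin

lemma const_1_concave_majorant: "(\<lambda>_. 1) \<in> concave_majorants (\<lambda>m. \<Sum>k<m. p k)"
  using prob_vector_le_1(1)[OF p] by (simp add: concave_majorants_def concave_seq_def)

lemma lcmaj_prob_vector_0: "lcmaj (\<lambda>m. \<Sum>k<m. p k) 0 = 0"
proof (rule antisym)
  \<comment> \<open>All entries are at most 1, so the identity is a concave majorant; it pins the
    least one to 0 at the origin.\<close>
  have "(\<Sum>k<m. p k) \<le> real m" for m
    using sum_bounded_above[of "{..<m}" p 1] prob_vector_le_1(2)[OF p] by simp
  then have "real \<in> concave_majorants (\<lambda>m. \<Sum>k<m. p k)"
    by (simp add: concave_majorants_def concave_seq_def)
  from lcmaj_least[OF this, of 0] show "lcmaj (\<lambda>m. \<Sum>k<m. p k) 0 \<le> 0" by simp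
  show "0 \<le> lcmaj (\<lambda>m. \<Sum>k<m. p k) 0"
  proof (rule lcmaj_greatest)
    show "concave_majorants (\<lambda>m. \<Sum>k<m. p k) \<noteq> {}"
      using const_1_concave_majorant by auto
    show "0 \<le> c 0" if "c \<in> concave_majorants (\<lambda>m. \<Sum>k<m. p k)" for c
      using that unfolding concave_majorants_def by (auto dest: spec[of _ 0])
  qed
qed

lemma sum_lcmaj_slopes: "(\<Sum>k<m. lcmaj_slopes p k) = lcmaj (\<lambda>m. \<Sum>k<m. p k) m"
  unfolding lcmaj_slopes_def sum_lessThan_telescope lcmaj_prob_vector_0 by simp

lemma sum_le_sum_lcmaj_slopes: "(\<Sum>k<m. p k) \<le> (\<Sum>k<m. lcmaj_slopes p k)"
  using lcmaj_in_concave_majorants[of "\<lambda>m. \<Sum>k<m. p k"] const_1_concave_majorant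
  unfolding sum_lcmaj_slopes by (auto simp: concave_majorants_def)

text \<open>Concavity makes the slopes decrease. Their partial sums are squeezed between those of
  \<open>p\<close> and 1, so the slopes sum to 1 and tend to 0; a decreasing null sequence is
  nonnegative.\<close>

lemma lcmaj_slopes_decreasing_pmf: "lcmaj_slopes p \<in> decreasing_pmfs"
proof -
  let ?g = "lcmaj_slopes p" and ?s = "\<lambda>m. \<Sum>k<m. p k"
  have "lcmaj ?s \<in> concave_majorants ?s"
    using const_1_concave_majorant by (intro lcmaj_in_concave_majorants) auto
  then have dec: "decseq ?g"
    unfolding concave_majorants_def lcmaj_slopes_def concave_seq_iff_decseq by simp
  have "(\<lambda>m. \<Sum>k<m. ?g k) \<longlonglongrightarrow> 1"
  proof (rule tendsto_sandwich)
    show "?s \<longlonglongrightarrow> 1" using p by (simp add: prob_vector_def sums_def)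
    show "(\<lambda>_. 1) \<longlonglongrightarrow> (1::real)" by simp
    show "\<forall>\<^sub>F m in sequentially. ?s m \<le> (\<Sum>k<m. ?g k)"
      using sum_le_sum_lcmaj_slopes by simp
    show "\<forall>\<^sub>F m in sequentially. (\<Sum>k<m. ?g k) \<le> 1"
      using lcmaj_least[OF const_1_concave_majorant] by (simp add: sum_lcmaj_slopes)
  qed
  then have sums: "?g sums 1" by (simp add: sums_def)
  then have "?g \<longlonglongrightarrow> 0" using sums_summable summable_LIMSEQ_zero by blast
  with dec have "0 \<le> ?g k" for k by (rule decseq_ge)
  with dec sums show ?thesis by (simp add: decreasing_pmfs_def prob_vector_def)
qed

lemma lcmaj_slopes_variational:
  assumes h: "h \<in> decreasing_pmfs"
  shows "(\<Sum>k. (p k - lcmaj_slopes p k) * (h k - lcmaj_slopes p k)) \<le> 0"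
proof -
  let ?g = "lcmaj_slopes p" and ?s = "\<lambda>m. \<Sum>k<m. p k"
  define e where "e m = ?s m - (\<Sum>k<m. ?g k)" for m
  have e0: "e 0 = 0" by (simp add: e_def)
  have e_diff: "e (Suc k) - e k = p k - ?g k" for k by (simp add: e_def)
  have e_le: "e k \<le> 0" for k using sum_le_sum_lcmaj_slopes[of k] by (simp add: e_def)
  have hp: "prob_vector h" and h_dec: "h (Suc k) \<le> h k" for k
    using h by (auto simp: decreasing_pmfs_def decseq_Suc_iff)
  have gp: "prob_vector ?g"
    using lcmaj_slopes_decreasing_pmf by (simp add: decreasing_pmfs_def)
  \<comment> \<open>Complementary slackness: either the majorant touches the partial sums at
    \<open>Suc k\<close>, or its slope does not change there.\<close>
  have contact: "e (Suc k) * (?g k - ?g (Suc k)) = 0" for k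
  proof (cases "e (Suc k) = 0")
    case False
    with e_le[of "Suc k"] have "?s (Suc k) < lcmaj ?s (Suc k)"
      unfolding e_def sum_lcmaj_slopes by linarith
    with const_1_concave_majorant have "?g (Suc k) = ?g k"
      unfolding lcmaj_slopes_def by (intro lcmaj_affine_off_contact) auto
    then show ?thesis by simp
  qed simp
  \<comment> \<open>Against \<open>h\<close> all terms after summation by parts are nonpositive;
    against \<open>?g\<close> only the boundary term survives, and it vanishes as \<open>m\<close>
    grows.\<close>
  have "(\<Sum>k<m. (p k - ?g k) * (h k - ?g k)) \<le> - (e m * ?g m)" for m
  proof -
    have "(\<Sum>k<m. (p k - ?g k) * h k) \<le> 0"
      unfolding e_diff[symmetric] summation_by_parts e0 using hp h_dec e_le
      by (auto simp: prob_vector_def intro!: add_nonpos_nonpos sum_nonpos mult_nonpos_nonneg)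
    moreover have "(\<Sum>k<m. (p k - ?g k) * ?g k) = e m * ?g m"
      unfolding e_diff[symmetric] summation_by_parts e0 by (simp add: contact)
    ultimately show ?thesis by (simp add: right_diff_distrib sum_subtractf)
  qed
  moreover have "(\<lambda>m. \<Sum>k<m. (p k - ?g k) * (h k - ?g k))
      \<longlonglongrightarrow> (\<Sum>k. (p k - ?g k) * (h k - ?g k))"
    by (intro summable_LIMSEQ summable_prob_vector_diff_mult p hp gp)
  moreover have "(\<lambda>m. - (e m * ?g m)) \<longlonglongrightarrow> - ((1 - 1) * 0)"
  proof -
    have "e \<longlonglongrightarrow> 1 - 1"
      unfolding e_def using p gp by (intro tendsto_diff) (auto simp: prob_vector_def sums_def)
    moreover have "?g \<longlonglongrightarrow> 0"
      using gp sums_summable summable_LIMSEQ_zero unfolding prob_vector_def by blast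
    ultimately show ?thesis by (intro tendsto_minus tendsto_mult)
  qed
  ultimately show ?thesis by (intro LIMSEQ_le[where y = 0]) auto
qed

text \<open>Expand the square of \<open>p - h = (p - g) - (h - g)\<close>, where \<open>g\<close> is
  \<open>lcmaj_slopes p\<close>; the variational inequality gives the cross term its sign.\<close>

lemma lcmaj_slopes_pythagoras:
  assumes h: "h \<in> decreasing_pmfs"
  shows "(\<Sum>k. (p k - lcmaj_slopes p k)\<^sup>2) + (\<Sum>k. (h k - lcmaj_slopes p k)\<^sup>2)
    \<le> (\<Sum>k. (p k - h k)\<^sup>2)"
proof -
  let ?g = "lcmaj_slopes p"
  have hp: "prob_vector h" and gp: "prob_vector ?g"
    using h lcmaj_slopes_decreasing_pmf by (auto simp: decreasing_pmfs_def)
  note sm = summable_prob_vector_diff_mult[OF p gp p gp] summable_prob_vector_diff_mult[OF hp gp hp gp]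
    summable_prob_vector_diff_mult[OF p gp hp gp]
  have "(\<lambda>k. (p k - ?g k) * (p k - ?g k) + (h k - ?g k) * (h k - ?g k)
      - 2 * ((p k - ?g k) * (h k - ?g k)))
    sums ((\<Sum>k. (p k - ?g k) * (p k - ?g k)) + (\<Sum>k. (h k - ?g k) * (h k - ?g k))
      - 2 * (\<Sum>k. (p k - ?g k) * (h k - ?g k)))"
    by (intro sums_diff sums_add sums_mult summable_sums sm)
  also have "(\<lambda>k. (p k - ?g k) * (p k - ?g k) + (h k - ?g k) * (h k - ?g k)
      - 2 * ((p k - ?g k) * (h k - ?g k))) = (\<lambda>k. (p k - h k)\<^sup>2)"
    by (simp add: fun_eq_iff power2_eq_square algebra_simps)
  finally show ?thesis
    using lcmaj_slopes_variational[OF h] by (simp add: sums_iff power2_eq_square)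
qed

lemma iso_proj_eq_lcmaj_slopes: "iso_proj p = lcmaj_slopes p"
proof -
  let ?g = "lcmaj_slopes p" and ?l = "\<lambda>g. l2_norm (\<lambda>j. p j - g j)"
  have gp: "prob_vector ?g"
    using lcmaj_slopes_decreasing_pmf by (simp add: decreasing_pmfs_def)
  have summable: "summable (\<lambda>k. (h k - ?g k)\<^sup>2)" if "h \<in> decreasing_pmfs" for h
    using that summable_prob_vector_diff_mult[OF _ gp _ gp, of h h]
    by (simp add: power2_eq_square decreasing_pmfs_def)
  have "?l ?g \<le> ?l h" if "h \<in> decreasing_pmfs" for h
    unfolding l2_norm_def real_sqrt_le_iff
    using lcmaj_slopes_pythagoras[OF that] suminf_nonneg[OF summable[OF that]] by simp
  then have "is_arg_min ?l (\<lambda>h. h \<in> decreasing_pmfs) ?g"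
    using lcmaj_slopes_decreasing_pmf by (auto simp: is_arg_min_linorder)
  \<comment> \<open>\<open>arg_min_on\<close> chooses some minimizer, and \<open>?g\<close>
    witnesses that one exists. The Pythagorean inequality then forces the chosen one to be at
    distance 0 from \<open>?g\<close>.\<close>
  then have "is_arg_min ?l (\<lambda>h. h \<in> decreasing_pmfs) (iso_proj p)"
    unfolding iso_proj_def arg_min_on_def arg_min_def
    by (rule someI[of "is_arg_min ?l (\<lambda>h. h \<in> decreasing_pmfs)"])
  then have ip: "iso_proj p \<in> decreasing_pmfs" and le: "?l (iso_proj p) \<le> ?l ?g"
    using lcmaj_slopes_decreasing_pmf by (auto simp: is_arg_min_linorder)
  from le have "(\<Sum>k. (iso_proj p k - ?g k)\<^sup>2) \<le> 0"
    unfolding l2_norm_def real_sqrt_le_iff using lcmaj_slopes_pythagoras[OF ip] by simp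
  then have "(\<Sum>k. (iso_proj p k - ?g k)\<^sup>2) = 0"
    using suminf_nonneg[OF summable[OF ip]] by simp
  then show ?thesis
    using suminf_eq_zero_iff[OF summable[OF ip]] by auto
qed

lemma marshall_inequality:
  assumes d: "d \<in> decreasing_pmfs"
    and bound: "\<And>j. \<bar>cumulative p j - cumulative d j\<bar> \<le> \<epsilon>"
  shows "\<bar>cumulative (iso_proj p) j - cumulative d j\<bar> \<le> \<epsilon>"
proof -
  let ?s = "\<lambda>m. \<Sum>k<m. p k"
  have cumulative: "cumulative f j = (\<Sum>k<Suc j. f k)" for f j
    by (simp add: cumulative_def atLeast0AtMost lessThan_Suc_atMost)
  have bound': "\<bar>?s (Suc m) - (\<Sum>k<Suc m. d k)\<bar> \<le> \<epsilon>" for m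
    using bound[of m] unfolding cumulative .
  have "?s m \<le> (\<Sum>k<m. d k) + \<epsilon>" for m
  \<comment> \<open>At \<open>m = 0\<close> both sums are empty and the claim is
    \<open>0 \<le> \<epsilon>\<close>, which follows from any instance of the bound.\<close>
  proof (cases m)
    case 0
    then show ?thesis using bound[of 0] by simp
  next
    case (Suc i)
    then show ?thesis using bound'[of i] by (simp only: Suc abs_le_iff) linarith
  qed
  then have "(\<lambda>m. (\<Sum>k<m. d k) + \<epsilon>) \<in> concave_majorants ?s"
    using d by (simp add: concave_majorants_def concave_seq_def decreasing_pmfs_def decseq_Suc_iff)
  from lcmaj_least[OF this] have "(\<Sum>k<Suc j. iso_proj p k) \<le> (\<Sum>k<Suc j. d k) + \<epsilon>"
    unfolding iso_proj_eq_lcmaj_slopes sum_lcmaj_slopes .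
  moreover have "?s (Suc j) \<le> (\<Sum>k<Suc j. iso_proj p k)"
    unfolding iso_proj_eq_lcmaj_slopes by (rule sum_le_sum_lcmaj_slopes)
  ultimately show ?thesis
    using bound'[of j] unfolding cumulative by (simp only: abs_le_iff) linarith
qed

end

section \<open>The Grenander--Stone estimator\<close>

lemma prob_vector_empirical_pmf:
  assumes "n > 0"
  shows "prob_vector (empirical_pmf n z)"
proof -
  \<comment> \<open>Each observation contributes a unit point mass at \<open>z i\<close>, so the
    counts sum to \<open>n\<close>.\<close>
  have "(\<lambda>j. \<Sum>i=1..n. of_bool (z i = j) :: real) sums (\<Sum>i=1..n. 1)"
    using sums_single[of "z i" "\<lambda>_. 1 :: real" for i]
    by (intro sums_sum) (simp add: of_bool_def eq_commute[of "z _"])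
  from sums_divide[OF this, of "real n"] assms have "empirical_pmf n z sums 1"
    unfolding empirical_pmf_def freq_def by simp
  then show ?thesis
    by (auto simp: prob_vector_def empirical_pmf_def freq_def intro!: divide_nonneg_nonneg sum_nonneg)
qed

text \<open>Each selection rule returns 0, 1, or a quotient \<open>b / a\<close> with
  \<open>0 \<le> b \<le> a\<close> and \<open>a \<noteq> 0\<close>.\<close>

lemma mixture_param_bounds: "0 \<le> mixture_param L n z" "mixture_param L n z \<le> 1"
  by (cases L; auto simp: beta_L1_def beta_L2_def Let_def divide_le_eq_1)+

lemma cumulative_le_1:
  assumes "prob_vector p"
  shows "0 \<le> cumulative p j" "cumulative p j \<le> 1"
  using assms prob_vector_le_1(1)[OF assms, of "Suc j"]
  by (auto simp: cumulative_def atLeast0AtMost lessThan_Suc_atMost prob_vector_def intro!: sum_nonneg)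

theorem theorem6:
  fixes n :: nat and z :: "nat \<Rightarrow> nat" and L :: loss and d :: "nat \<Rightarrow> real"
  assumes "n \<ge> 2"
    and "d \<in> decreasing_pmfs"
  shows "sup_norm (\<lambda>j. cumulative (grenander_stone L n z) j - cumulative d j)
           \<le> sup_norm (\<lambda>j. cumulative (empirical_pmf n z) j - cumulative d j)"
proof -
  let ?p = "empirical_pmf n z" and ?b = "mixture_param L n z"
  define \<epsilon> where "\<epsilon> = sup_norm (\<lambda>j. cumulative ?p j - cumulative d j)"
  have p: "prob_vector ?p" using assms(1) by (intro prob_vector_empirical_pmf) simp
  have d: "prob_vector d" using assms(2) by (simp add: decreasing_pmfs_def)
  have "\<bar>cumulative ?p j - cumulative d j\<bar> \<le> 1" for j
    using cumulative_le_1[OF p, of j] cumulative_le_1[OF d, of j] by linarith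
  \<comment> \<open>A real supremum is an upper bound only of a set that is bounded above; here
    distribution functions lie between 0 and 1.\<close>
  then have bdd: "bdd_above (range (\<lambda>j. \<bar>cumulative ?p j - cumulative d j\<bar>))"
    by (auto simp: bdd_above_def)
  have F: "\<bar>cumulative ?p j - cumulative d j\<bar> \<le> \<epsilon>" for j
    unfolding \<epsilon>_def sup_norm_def by (rule cSUP_upper[OF _ bdd]) simp
  have G: "\<bar>cumulative (iso_proj ?p) j - cumulative d j\<bar> \<le> \<epsilon>" for j
    by (rule marshall_inequality[OF p assms(2) F])
  have "\<bar>cumulative (grenander_stone L n z) j - cumulative d j\<bar> \<le> \<epsilon>" for j
  proof -
    \<comment> \<open>Cumulation is linear, and the weights add up to 1, so \<open>d\<close> can be
      split between the two parts of the mixture.\<close>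
    have "cumulative (grenander_stone L n z) j - cumulative d j =
      ?b * (cumulative (iso_proj ?p) j - cumulative d j) + (1 - ?b) * (cumulative ?p j - cumulative d j)"
      by (simp add: cumulative_def grenander_stone_def grenander_def sum.distrib sum_distrib_left
          algebra_simps sum_subtractf)
    also have "\<bar>\<dots>\<bar> \<le> ?b * \<epsilon> + (1 - ?b) * \<epsilon>"
      using mixture_param_bounds[of L n z] F[of j] G[of j]
      by (intro order.trans[OF abs_triangle_ineq] add_mono) (auto simp: abs_mult intro!: mult_left_mono)
    finally show ?thesis by (simp add: algebra_simps)
  qed
  then show ?thesis
    unfolding \<epsilon>_def[symmetric] by (auto simp: sup_norm_def intro!: cSUP_least)
qed

end
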